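(* There exists a $2$-coloring of $\mathbb{N}$ for which there is no infinite set $B\subseteq\mathbb{N}$ such that $B+B+B$ is monochromatic.
   Context: $\mathbb{N}=\{1,2,3,\ldots\}$. For $B\subseteq\mathbb{N}$, $B+B+B=\{x+y+z:x,y,z\in B\}$, with repetitions among $x,y,z$ allowed. A $2$-coloring of $\mathbb{N}$ is a map from $\mathbb{N}$ to a two-element set; a subset is monochromatic if the coloring is constant on it. *)

theory Defs
  imports "HOL-Analysis.Analysis" "HOL-Library.Set_Algebras"
begin

text \<open>
  The positive integers are represented as \<open>{1..}\<close> in type \<open>nat\<close>. A coloring is a total
  function on \<open>nat\<close>; its value at \<open>0\<close> never matters, since \<open>B + B + B\<close> does not contain \<open>0\<close>
  when \<open>B\<close> is contained in \<open>{1..}\<close>. The sum of sets is the elementwise one of \<open>Set_Algebras\<close>.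
\<close>

abbreviation monochromatic :: "('a \<Rightarrow> 'b) \<Rightarrow> 'a set \<Rightarrow> bool" where
  "monochromatic c S \<equiv> c constant_on S"

end

theory Submission
  imports Defs
begin

text \<open>
  Color \<open>n\<close> by the parity of \<open>\<lfloor>log\<^bsub>b\<^esub> n\<rfloor>\<close> for a base \<open>b\<close> with \<open>2 < b < 3\<close>; here \<open>b = 5/2\<close>.
  If \<open>x\<close> and \<open>y\<close> are elements of \<open>B\<close> and \<open>y\<close> is much larger than \<open>x\<close>, then \<open>B + B + B\<close> contains
  the numbers \<open>y + 2x < 2y + x < 3y\<close>. Each of the two successive quotients is at most \<open>2 < b\<close>, so
  the rounded logarithm grows by at most one at each step; being of constant parity, it does not
  grow at all. But \<open>3y / (y + 2x)\<close> is close to \<open>3 > b\<close>, so it must grow between the first number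
  and the last.
\<close>

text \<open>
  The coloring: it is constant on each interval \<open>[(5/2)^k, (5/2)^(k+1))\<close> and alternates with \<open>k\<close>.
  Its value at \<open>0\<close> is irrelevant.
\<close>

definition log_parity :: "nat \<Rightarrow> bool" where
  "log_parity n = even \<lfloor>log (5/2) (real n)\<rfloor>"

lemma floor_log_eq_if_log_parity_eq:
  assumes "0 < m" "m \<le> n" "2 * n < 5 * m" "log_parity m = log_parity n"
  shows "\<lfloor>log (5/2) (real m)\<rfloor> = \<lfloor>log (5/2) (real n)\<rfloor>"
proof -
  have "log (5/2) (real m) \<le> log (5/2) (real n)"
    using assms by simp
  moreover have "log (5/2) (real n) < log (5/2) (5/2 * real m)"
    using assms by (subst log_less_cancel_iff) auto
  moreover have "log (5/2) (5/2 * real m) = 1 + log (5/2) (real m)"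
    using assms by (subst log_mult) auto
  ultimately have "\<lfloor>log (5/2) (real n)\<rfloor> = \<lfloor>log (5/2) (real m)\<rfloor>
      \<or> \<lfloor>log (5/2) (real n)\<rfloor> = \<lfloor>log (5/2) (real m)\<rfloor> + 1"
    by linarith
  then show ?thesis
    using assms(4) unfolding log_parity_def by auto
qed

lemma floor_log_less:
  assumes "0 < m" "5 * m \<le> 2 * n"
  shows "\<lfloor>log (5/2) (real m)\<rfloor> < \<lfloor>log (5/2) (real n)\<rfloor>"
proof -
  have "log (5/2) (5/2 * real m) \<le> log (5/2) (real n)"
    using assms by (subst log_le_cancel_iff) auto
  moreover have "log (5/2) (5/2 * real m) = 1 + log (5/2) (real m)"
    using assms by (subst log_mult) auto
  ultimately show ?thesis
    by linarith
qed

lemma not_monochromatic_log_parity: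
  assumes "B \<subseteq> {1..}" "infinite B"
  shows "\<not> monochromatic log_parity (B + B + B)"
proof
  assume "monochromatic log_parity (B + B + B)"
  then have mono: "log_parity u = log_parity v" if "u \<in> B + B + B" "v \<in> B + B + B" for u v
    using that unfolding constant_on_def by metis
  obtain x where x: "x \<in> B" "0 < x"
    using assms by (metis atLeast_iff finite.emptyI less_le_trans less_one subsetD ex_in_conv)
  \<comment> \<open>\<open>10 x \<le> y\<close> is what makes \<open>3 y\<close> at least \<open>5/2\<close> times \<open>y + 2 x\<close>.\<close>
  obtain y where y: "y \<in> B" "10 * x < y"
    using assms(2) unfolding infinite_nat_iff_unbounded by blast
  have "y + x + x \<in> B + B + B" "y + y + x \<in> B + B + B" "y + y + y \<in> B + B + B"
    using x y by (auto intro!: set_plus_intro)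
  then have "log_parity (y + x + x) = log_parity (y + y + x)"
    "log_parity (y + y + x) = log_parity (y + y + y)"
    using mono by blast+
  then have "\<lfloor>log (5/2) (real (y + x + x))\<rfloor> = \<lfloor>log (5/2) (real (y + y + x))\<rfloor>"
    "\<lfloor>log (5/2) (real (y + y + x))\<rfloor> = \<lfloor>log (5/2) (real (y + y + y))\<rfloor>"
    using x y by (auto intro!: floor_log_eq_if_log_parity_eq simp del: of_nat_add)
  moreover have "\<lfloor>log (5/2) (real (y + x + x))\<rfloor> < \<lfloor>log (5/2) (real (y + y + y))\<rfloor>"
    using x y by (intro floor_log_less) auto
  ultimately show False
    by linarith
qed

theorem mainTheorem5:
  shows "\<exists>c :: nat \<Rightarrow> bool.
    \<not> (\<exists>B \<subseteq> {1..}. infinite B \<and> monochromatic c (B + B + B))"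
  using not_monochromatic_log_parity by blast

end
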